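(* Let $\mathcal H,\mathcal F$ be real or complex Hilbert spaces, $A\in L(\mathcal H,\mathcal F)$, $b\in\mathcal F$, and let $W\in L(\mathcal F)$ be positive semidefinite with $W^{1/2}\in S_2$. Suppose $b\notin R(A)+N(W)$. If $\dim(\mathcal H)=\infty$, then the problem $$\min_{X\in L(\mathcal H,\mathcal F),\ x\in\mathcal H}\ \|A-X\|_{2,W}^2+\|Xx-b\|_W^2$$ does not have a solution, i.e. the infimum is not attained by any pair $(X,x)\in L(\mathcal H,\mathcal F)\times\mathcal H$.
   Context: $L(\mathcal H,\mathcal F)$ denotes the bounded linear operators, $R(\cdot)$ range, $N(\cdot)$ nullspace. $S_2$ is the Hilbert–Schmidt class with norm $\|\cdot\|_2$. Seminorms: $\|X\|_{2,W}:=\|W^{1/2}X\|_2$ for $X\in L(\mathcal H,\mathcal F)$ and $\|z\|_W:=\|W^{1/2}z\|$ for $z\in\mathcal F$. *)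

theory Defs
  imports "HOL-Analysis.Analysis"
begin

(* Common interface to the scalar fields of real and of complex Hilbert spaces. By the
   Gelfand-Mazur theorem every real_normed_field is isometrically isomorphic to the reals or to the
   complex numbers, and the last axiom then forces kcnj to be the usual conjugation, so up to
   isomorphism the two instances below are the only ones. *)
class real_or_complex = real_normed_field +
  fixes kcnj :: "'a \<Rightarrow> 'a"
  assumes kcnj_add: "kcnj (x + y) = kcnj x + kcnj y"
    and kcnj_mult: "kcnj (x * y) = kcnj x * kcnj y"
    and kcnj_scaleR: "kcnj (r *\<^sub>R x) = r *\<^sub>R kcnj x"
    and mult_kcnj: "x * kcnj x = (norm x)\<^sup>2 *\<^sub>R 1"

instantiation real :: real_or_complex
begin
definition kcnj_real :: "real \<Rightarrow> real" where "kcnj_real x = x"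
instance by standard (auto simp: kcnj_real_def power2_eq_square)
end

instantiation complex :: real_or_complex
begin
definition kcnj_complex :: "complex \<Rightarrow> complex" where "kcnj_complex x = cnj x"
instance by standard (auto simp: kcnj_complex_def complex_norm_square scaleR_conv_of_real simp del: of_real_power)
end

definition bounded_ops ::
  "('k::real_or_complex \<Rightarrow> 'h::real_normed_vector \<Rightarrow> 'h) \<Rightarrow>
   ('k \<Rightarrow> 'f::real_normed_vector \<Rightarrow> 'f) \<Rightarrow> ('h \<Rightarrow> 'f) set"
  where "bounded_ops sH sF =
    {X. Vector_Spaces.linear sH sF X \<and> (\<exists>K. \<forall>x. norm (X x) \<le> K * norm x)}"

(* Completeness and the norm topology come from the class banach; ip_self says that the norm of that
   class is the one induced by the inner product. The inner product is linear in its first argument. *)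
locale hilbert_space = vector_space scale
  for scale :: "'k::real_or_complex \<Rightarrow> 'h::banach \<Rightarrow> 'h" +
  fixes ip :: "'h \<Rightarrow> 'h \<Rightarrow> 'k"
  assumes scale_of_real: "scale (of_real r) x = r *\<^sub>R x"
    and ip_add_left: "ip (x + y) z = ip x z + ip y z"
    and ip_scale_left: "ip (scale c x) y = c * ip x y"
    and ip_commute: "ip x y = kcnj (ip y x)"
    and ip_self: "ip x x = of_real ((norm x)\<^sup>2)"
begin

definition finite_dim :: bool
  where "finite_dim \<longleftrightarrow> (\<exists>B. finite B \<and> span B = UNIV)"

definition orthonormal_basis :: "'h set \<Rightarrow> bool"
  where "orthonormal_basis E \<longleftrightarrow>
    (\<forall>e\<in>E. norm e = 1) \<and> pairwise (\<lambda>x y. ip x y = 0) E \<and> closure (span E) = UNIV"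

(* Self-adjointness has to be required separately: over the reals it does not follow from the
   condition on the quadratic form. *)
definition positive_semidefinite :: "('h \<Rightarrow> 'h) \<Rightarrow> bool"
  where "positive_semidefinite W \<longleftrightarrow> W \<in> bounded_ops scale scale \<and>
    (\<forall>x y. ip (W x) y = ip x (W y)) \<and> (\<forall>x. \<exists>r\<ge>0. ip (W x) x = of_real r)"

definition sqrt_op :: "('h \<Rightarrow> 'h) \<Rightarrow> 'h \<Rightarrow> 'h"
  where "sqrt_op W = (THE S. positive_semidefinite S \<and> S \<circ> S = W)"

definition weighted_norm :: "('h \<Rightarrow> 'h) \<Rightarrow> 'h \<Rightarrow> real"
  where "weighted_norm W z = norm (sqrt_op W z)"

definition hilbert_schmidt :: "('k \<Rightarrow> 'f::real_normed_vector \<Rightarrow> 'f) \<Rightarrow> ('h \<Rightarrow> 'f) set"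
  where "hilbert_schmidt sF = {X \<in> bounded_ops scale sF.
    \<exists>E. orthonormal_basis E \<and> (\<lambda>e. (norm (X e))\<^sup>2) summable_on E}"

(* The sum does not depend on the choice of the orthonormal basis. It is only meaningful for
   Hilbert-Schmidt operators, as infsum is 0 on families that are not summable. *)
definition hs_norm :: "('h \<Rightarrow> 'f::real_normed_vector) \<Rightarrow> real"
  where "hs_norm X = sqrt (\<Sum>\<^sub>\<infinity>e\<in>(SOME E. orthonormal_basis E). (norm (X e))\<^sup>2)"

end

definition weighted_hs_norm ::
  "('k::real_or_complex \<Rightarrow> 'h::banach \<Rightarrow> 'h) \<Rightarrow> ('h \<Rightarrow> 'h \<Rightarrow> 'k) \<Rightarrow>
   ('k \<Rightarrow> 'f::banach \<Rightarrow> 'f) \<Rightarrow> ('f \<Rightarrow> 'f \<Rightarrow> 'k) \<Rightarrow> ('f \<Rightarrow> 'f) \<Rightarrow> ('h \<Rightarrow> 'f) \<Rightarrow> real"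
  where "weighted_hs_norm sH ipH sF ipF W X =
    hilbert_space.hs_norm sH ipH (hilbert_space.sqrt_op sF ipF W \<circ> X)"

lemma hilbert_space_real:
  "hilbert_space scaleR (inner :: 'a::{real_inner, banach} \<Rightarrow> 'a \<Rightarrow> real)"
  by unfold_locales
    (auto simp: kcnj_real_def inner_add_left inner_commute power2_norm_eq_inner algebra_simps)

lemma hilbert_space_complex: "hilbert_space (*) (\<lambda>x y :: complex. x * cnj y)"
  by unfold_locales
    (auto simp: kcnj_complex_def algebra_simps scaleR_conv_of_real complex_norm_square
      simp del: of_real_power)

end

theory Submission
  imports Defs
begin

text \<open>
Write \<open>S\<close> for the positive square root of \<open>W\<close>. The value of the problem is \<open>0\<close>, and this
value cannot be attained when \<open>b\<close> lies outside the sum of the range of \<open>A\<close> and the kernel of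
\<open>W\<close>.

The infimum is \<open>0\<close> because an equation \<open>X x = b\<close> can be enforced by a rank-one change of \<open>A\<close>,
and this change is cheap along a suitable \<open>x\<close>. Since \<open>S\<close> is Hilbert-Schmidt and \<open>A\<close> bounded, the
family \<open>(norm (S (A e)))\<^sup>2\<close> is summable over an orthonormal basis of the domain. That basis is
infinite, so some \<open>norm (S (A e))\<close> is as small as desired. With \<open>x = t e\<close>, the operator
\<open>X h = A h + (ip h e / t) (b - A x)\<close> satisfies \<open>X x = b\<close>, and the weighted Hilbert-Schmidt norm of
\<open>A - X\<close> is \<open>norm (S (b - t (A e))) / t \<le> norm (S b) / t + norm (S (A e))\<close>. A large \<open>t\<close> makes
this small (\<open>exact_solution_near_A\<close>).

A minimiser \<open>(X, x)\<close> would therefore have value \<open>0\<close>. Then \<open>S (A - X)\<close> vanishes on an orthonormal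
basis, hence everywhere, and \<open>S (X x - b) = 0\<close>. Adding the two gives \<open>S (b - A x) = 0\<close>, so
\<open>b - A x\<close> is in the kernel of \<open>W\<close>, contrary to the choice of \<open>b\<close>.

Three facts of Hilbert space theory carry this argument. First, \<open>W\<close> has exactly one
positive semidefinite square root, so that the description defining \<open>sqrt_op\<close> denotes it
(\<open>psd_sqrt_exists\<close>, \<open>psd_sqrt_unique\<close>). Second, orthonormal bases exist
(\<open>orthonormal_basis_exists\<close>), so that \<open>hs_norm\<close> is computed in one. Third, \<open>S D\<close> has a summable family of squared norms over every
orthonormal set for bounded \<open>D\<close> (\<open>hilbert_schmidt_comp_summable\<close>); without this a vanishing
\<open>hs_norm\<close> would say nothing about \<open>S D\<close>.
\<close>

section \<open>Scalars and the inner product\<close>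

lemma kcnj_of_real [simp]: "kcnj (of_real r :: 'k::real_or_complex) = of_real r"
  using mult_kcnj[of "1 :: 'k"] by (simp add: of_real_def kcnj_scaleR)

lemma kcnj_zero [simp]: "kcnj (0 :: 'k::real_or_complex) = 0"
  using kcnj_of_real[of 0] by simp

lemma norm_kcnj [simp]: "norm (kcnj (x :: 'k::real_or_complex)) = norm x"
proof (cases "x = 0")
  case False
  have "norm x * norm (kcnj x) = norm x * norm x"
    using arg_cong[OF mult_kcnj[of x], of norm] by (simp add: norm_mult power2_eq_square)
  with False show ?thesis by simp
qed simp

lemma kcnj_minus [simp]: "kcnj (- x :: 'k::real_or_complex) = - kcnj x"
  using kcnj_scaleR[of "-1" x] by simp

lemma kcnj_diff: "kcnj (x - y :: 'k::real_or_complex) = kcnj x - kcnj y"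
  using kcnj_add[of x "- y"] by simp

lemma mult_kcnj_of_real: "x * kcnj x = (of_real ((norm x)\<^sup>2) :: 'k::real_or_complex)"
  by (simp add: mult_kcnj of_real_def del: of_real_power)

context hilbert_space
begin

lemma ip_add_right: "ip x (y + z) = ip x y + ip x z"
  by (metis ip_commute ip_add_left kcnj_add)

lemma ip_scale_right: "ip x (scale c y) = kcnj c * ip x y"
  by (metis ip_commute ip_scale_left kcnj_mult)

lemma ip_zero_left [simp]: "ip 0 x = 0"
  using ip_add_left[of 0 0 x] by simp

lemma ip_zero_right [simp]: "ip x 0 = 0"
  using ip_add_right[of x 0 0] by simp

lemma ip_minus_left [simp]: "ip (- x) y = - ip x y"
  using ip_add_left[of x "- x" y] by (simp add: eq_neg_iff_add_eq_0 add.commute)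

lemma ip_minus_right [simp]: "ip x (- y) = - ip x y"
  by (metis ip_commute ip_minus_left kcnj_minus)

lemma ip_diff_left: "ip (x - y) z = ip x z - ip y z"
  using ip_add_left[of x "- y" z] by simp

lemma ip_diff_right: "ip x (y - z) = ip x y - ip x z"
  using ip_add_right[of x y "- z"] by simp

lemma ip_scaleR_left: "ip (r *\<^sub>R x) y = of_real r * ip x y"
  by (metis ip_scale_left scale_of_real)

lemma ip_scaleR_right: "ip x (r *\<^sub>R y) = of_real r * ip x y"
  by (metis ip_scale_right scale_of_real kcnj_of_real)

lemma ip_sum_left: "ip (sum f A) y = (\<Sum>a\<in>A. ip (f a) y)"
  by (induction A rule: infinite_finite_induct) (auto simp: ip_add_left)

lemma norm_scale: "norm (scale c x) = norm c * norm x"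
proof -
  have "of_real ((norm (scale c x))\<^sup>2) = ip (scale c x) (scale c x)" by (simp only: ip_self)
  also have "\<dots> = (c * kcnj c) * ip x x" by (simp add: ip_scale_left ip_scale_right)
  also have "\<dots> = of_real ((norm c * norm x)\<^sup>2)"
    by (simp only: mult_kcnj_of_real ip_self of_real_mult power_mult_distrib)
  finally have "(norm (scale c x))\<^sup>2 = (norm c * norm x)\<^sup>2" by (simp only: of_real_eq_iff)
  then show ?thesis by (simp add: power2_eq_iff_nonneg)
qed

text \<open>
The real part of the inner product, written by polarization because the abstract scalar
field carries no real-part function. It makes order arguments about quadratic forms available over
both scalar fields, and the Cauchy-Schwarz inequality for it is just the triangle inequality.
\<close>

definition real_ip :: "'h \<Rightarrow> 'h \<Rightarrow> real"
  where "real_ip x y = ((norm (x + y))\<^sup>2 - (norm x)\<^sup>2 - (norm y)\<^sup>2) / 2"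

lemma of_real_real_ip: "of_real (2 * real_ip x y) = ip x y + ip y x"
proof -
  have "of_real (2 * real_ip x y) = ip (x + y) (x + y) - ip x x - ip y y"
    by (simp add: real_ip_def ip_self)
  then show ?thesis by (simp add: ip_add_left ip_add_right)
qed

lemma real_ip_eqI: "of_real (2 * r) = ip x y + ip y x \<Longrightarrow> real_ip x y = r"
  by (metis of_real_real_ip of_real_eq_iff mult_cancel_left zero_neq_numeral)

lemma ip_eq_of_real_real_ip: "ip x y = of_real r \<Longrightarrow> real_ip x y = r"
  by (rule real_ip_eqI) (metis ip_commute kcnj_of_real mult_2 of_real_add)

lemma real_ip_commute: "real_ip x y = real_ip y x"
  by (simp add: real_ip_def add.commute)

lemma real_ip_self: "real_ip x x = (norm x)\<^sup>2"
  by (rule ip_eq_of_real_real_ip) (rule ip_self)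

lemma real_ip_add_left: "real_ip (x + y) z = real_ip x z + real_ip y z"
proof (rule real_ip_eqI)
  have "of_real (2 * (real_ip x z + real_ip y z))
      = of_real (2 * real_ip x z) + (of_real (2 * real_ip y z) :: 'k)"
    by (simp add: distrib_left)
  then show "of_real (2 * (real_ip x z + real_ip y z)) = ip (x + y) z + ip z (x + y)"
    by (simp only: of_real_real_ip ip_add_left ip_add_right ac_simps)
qed

lemma real_ip_scaleR_left: "real_ip (r *\<^sub>R x) z = r * real_ip x z"
proof (rule real_ip_eqI)
  have "of_real (2 * (r * real_ip x z)) = of_real r * (of_real (2 * real_ip x z) :: 'k)"
    by simp
  then show "of_real (2 * (r * real_ip x z)) = ip (r *\<^sub>R x) z + ip z (r *\<^sub>R x)"
    by (simp only: of_real_real_ip ip_scaleR_left ip_scaleR_right distrib_left)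
qed

lemma real_ip_add_right: "real_ip z (x + y) = real_ip z x + real_ip z y"
  by (metis real_ip_add_left real_ip_commute)

lemma real_ip_scaleR_right: "real_ip z (r *\<^sub>R x) = r * real_ip z x"
  by (metis real_ip_scaleR_left real_ip_commute)

lemma real_ip_diff_left: "real_ip (x - y) z = real_ip x z - real_ip y z"
  using real_ip_add_left[of "x - y" y z] by simp

lemma real_ip_diff_right: "real_ip z (x - y) = real_ip z x - real_ip z y"
  by (metis real_ip_diff_left real_ip_commute)

lemmas real_ip_simps = real_ip_add_left real_ip_add_right real_ip_diff_left real_ip_diff_right
  real_ip_scaleR_left real_ip_scaleR_right

lemma real_ip_le_norm: "real_ip x y \<le> norm x * norm y"
proof -
  have "(norm (x + y))\<^sup>2 \<le> (norm x + norm y)\<^sup>2"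
    by (intro power_mono norm_triangle_ineq) auto
  then show ?thesis by (simp add: real_ip_def power2_eq_square algebra_simps)
qed

text \<open>
The scalar \<open>kcnj (ip x y)\<close> rotates \<open>x\<close> so that its inner product with \<open>y\<close> becomes real, which reduces
the claim to the real part.
\<close>

lemma Cauchy_Schwarz: "norm (ip x y) \<le> norm x * norm y"
proof -
  let ?c = "ip x y"
  have "ip (scale (kcnj ?c) x) y = of_real ((norm ?c)\<^sup>2)"
    by (simp only: ip_scale_left mult_kcnj_of_real mult.commute[of _ ?c])
  then have "(norm ?c)\<^sup>2 = real_ip (scale (kcnj ?c) x) y"
    by (simp only: ip_eq_of_real_real_ip)
  also have "\<dots> \<le> norm ?c * (norm x * norm y)"
    using real_ip_le_norm[of "scale (kcnj ?c) x" y] by (simp add: norm_scale)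
  finally show ?thesis
    by (cases "?c = 0") (auto simp: power2_eq_square)
qed

lemma bounded_linear_scale: "bounded_linear (scale c)"
  by (rule bounded_linear_intro[where K = "norm c"])
    (simp_all add: scale_right_distrib norm_scale scale_of_real[symmetric] scale_left_commute)

lemma bounded_linear_ip_left: "bounded_linear (\<lambda>x. ip x y)"
  by (rule bounded_linear_intro[where K = "norm y"])
    (auto simp: ip_add_left ip_scaleR_left scaleR_conv_of_real Cauchy_Schwarz)

lemma bounded_linear_ip_right: "bounded_linear (\<lambda>y. ip x y)"
  by (rule bounded_linear_intro[where K = "norm x"])
    (auto simp: ip_add_right ip_scaleR_right scaleR_conv_of_real mult.commute[of _ "norm x"]
      Cauchy_Schwarz)

end

section \<open>Bounded and positive semidefinite operators\<close>

text \<open>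
This splits membership into real-linear boundedness, which gives access to the operator norm and its
topology, and commutation with the scalars, which survives the constructions below.
\<close>

lemma bounded_ops_iff:
  assumes "hilbert_space sH ipH" "hilbert_space sF ipF"
  shows "D \<in> bounded_ops sH sF \<longleftrightarrow> bounded_linear D \<and> (\<forall>c x. D (sH c x) = sF c (D x))"
proof -
  interpret H: hilbert_space sH ipH by fact
  interpret F: hilbert_space sF ipF by fact
  show ?thesis
  proof
    assume "D \<in> bounded_ops sH sF"
    then obtain K where lin: "\<And>x y. D (x + y) = D x + D y" "\<And>c x. D (sH c x) = sF c (D x)"
      and K: "\<And>x. norm (D x) \<le> K * norm x"
      by (auto simp: bounded_ops_def Vector_Spaces.linear_iff)
    have "bounded_linear D"
      by (rule bounded_linear_intro[where K = K])
        (simp_all add: lin K mult.commute[of _ K] flip: H.scale_of_real F.scale_of_real)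
    with lin(2) show "bounded_linear D \<and> (\<forall>c x. D (sH c x) = sF c (D x))" by blast
  next
    assume D: "bounded_linear D \<and> (\<forall>c x. D (sH c x) = sF c (D x))"
    then obtain K where "\<And>x. norm (D x) \<le> norm x * K"
      using bounded_linear.bounded by blast
    with D show "D \<in> bounded_ops sH sF"
      by (auto simp: bounded_ops_def Vector_Spaces.linear_iff linear_simps
          H.vector_space_axioms F.vector_space_axioms mult.commute)
  qed
qed

context hilbert_space
begin

lemmas endo_bounded_ops_iff = bounded_ops_iff[OF hilbert_space_axioms hilbert_space_axioms]

lemma psd_bounded_linear: "positive_semidefinite Q \<Longrightarrow> bounded_linear Q"
  by (simp add: positive_semidefinite_def endo_bounded_ops_iff)

lemma psd_real_ip:
  assumes "positive_semidefinite Q"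
  shows psd_real_ip_symmetric: "real_ip (Q x) y = real_ip x (Q y)"
    and psd_real_ip_nonneg: "real_ip (Q x) x \<ge> 0"
proof -
  have sym: "ip (Q x) y = ip x (Q y)" for x y
    using assms by (auto simp: positive_semidefinite_def)
  show "real_ip (Q x) y = real_ip x (Q y)"
    by (rule real_ip_eqI) (simp only: of_real_real_ip sym)
  obtain r where "r \<ge> 0" "ip (Q x) x = of_real r"
    using assms unfolding positive_semidefinite_def by blast
  then show "real_ip (Q x) x \<ge> 0" by (simp add: ip_eq_of_real_real_ip)
qed

text \<open>
Nonnegativity of the quadratic form of \<open>Q\<close> at the point \<open>x - t *\<^sub>R Q x\<close>. Suitable choices of \<open>t\<close> give
the two consequences below, which replace the Cauchy-Schwarz inequality for the form of \<open>Q\<close>.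
\<close>

lemma psd_quadratic:
  assumes Q: "positive_semidefinite Q"
  shows "real_ip (Q x) x - 2 * t * (norm (Q x))\<^sup>2 + t\<^sup>2 * real_ip (Q (Q x)) (Q x) \<ge> 0"
proof -
  interpret bounded_linear Q
    by (rule psd_bounded_linear[OF Q])
  have "0 \<le> real_ip (Q (x - t *\<^sub>R Q x)) (x - t *\<^sub>R Q x)"
    by (rule psd_real_ip_nonneg[OF Q])
  also have "\<dots> = real_ip (Q x) x - 2 * t * (norm (Q x))\<^sup>2 + t\<^sup>2 * real_ip (Q (Q x)) (Q x)"
    using psd_real_ip_symmetric[OF Q, of "Q x" x]
    by (simp add: diff scaleR real_ip_simps real_ip_self algebra_simps power2_eq_square)
  finally show ?thesis .
qed

lemma psd_kernel:
  assumes Q: "positive_semidefinite Q" and "real_ip (Q x) x = 0"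
  shows "Q x = 0"
proof -
  define a c where "a = (norm (Q x))\<^sup>2" and "c = real_ip (Q (Q x)) (Q x)"
  have c: "c \<ge> 0" unfolding c_def by (rule psd_real_ip_nonneg[OF Q])
  have a: "a \<ge> 0" by (simp add: a_def)
  \<comment> \<open>At \<open>t = a / (c + 1)\<close> the linear term of \<open>psd_quadratic\<close> outweighs the quadratic one unless
    \<open>a = 0\<close>; the \<open>1\<close> in the denominator covers the case \<open>c = 0\<close>.\<close>
  have "2 * (a / (c + 1)) * a \<le> (a / (c + 1))\<^sup>2 * c"
    using psd_quadratic[OF Q, of x "a / (c + 1)"] assms(2) by (simp add: a_def c_def)
  also have "\<dots> = (a / (c + 1)) * (a * (c / (c + 1)))" by (simp add: power2_eq_square)
  also have "\<dots> \<le> (a / (c + 1)) * (a * 1)"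
    using a c by (intro mult_left_mono) auto
  finally have "(a * a) / (c + 1) \<le> 0" by simp
  then have "a * a \<le> 0" using c by (simp add: divide_le_0_iff)
  then have "a = 0" using a by (simp add: mult_le_0_iff)
  then show ?thesis by (simp add: a_def)
qed

lemma psd_contraction:
  assumes Q: "positive_semidefinite Q" and "\<And>x. real_ip (Q x) x \<le> (norm x)\<^sup>2"
  shows "norm (Q x) \<le> norm x"
proof -
  have "(norm (Q x))\<^sup>2 \<le> (norm x)\<^sup>2"
    using psd_quadratic[OF Q, of x 1, simplified] assms(2)[of x] assms(2)[of "Q x"] by linarith
  then show ?thesis by (rule power2_le_imp_le) simp
qed

end

section \<open>Square roots of positive semidefinite operators\<close>

text \<open>
A fixed point \<open>Y\<close> of \<open>Z \<mapsto> (T + Z\<^sup>2) / 2\<close> satisfies \<open>(1 - Y)\<^sup>2 = 1 - T\<close>, so \<open>1 - Y\<close> is a square root of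
\<open>1 - T\<close>. The iteration from \<open>0\<close> converges in the operator norm even when \<open>norm T = 1\<close>, where it
need not be a contraction: the increments of the operator iterates are dominated by those of the
scalar iteration \<open>y \<mapsto> (1 + y\<^sup>2) / 2\<close>, which increases and is bounded by \<open>1\<close>. The last clause
transfers to \<open>Y\<close> every closed property that the iteration preserves.
\<close>

lemma sqrt_iteration:
  fixes T :: "'b::banach \<Rightarrow>\<^sub>L 'b"
  assumes T: "norm T \<le> 1"
  obtains Y where "norm Y \<le> 1" "Y = (1/2) *\<^sub>R (T + (Y o\<^sub>L Y))"
    "\<forall>C. closed C \<longrightarrow> 0 \<in> C \<longrightarrow> (\<forall>Z\<in>C. (1/2) *\<^sub>R (T + (Z o\<^sub>L Z)) \<in> C) \<longrightarrow> Y \<in> C"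
proof -
  interpret comp: bounded_bilinear "(o\<^sub>L) :: ('b \<Rightarrow>\<^sub>L 'b) \<Rightarrow> _" by (rule bounded_bilinear_blinfun_compose)
  define Y where "Y = rec_nat 0 (\<lambda>_ Z. (1/2) *\<^sub>R (T + (Z o\<^sub>L Z)))"
  define y where "y = rec_nat (0::real) (\<lambda>_ z. (1 + z\<^sup>2) / 2)"
  have Y0: "Y 0 = 0" and YS: "Y (Suc n) = (1/2) *\<^sub>R (T + (Y n o\<^sub>L Y n))" for n
    by (simp_all add: Y_def)
  have y0: "y 0 = 0" and yS: "y (Suc n) = (1 + (y n)\<^sup>2) / 2" for n
    by (simp_all add: y_def)
  have y1: "0 \<le> y n \<and> y n \<le> 1" for n
    by (induction n) (auto simp: y0 yS power_le_one)
  have Yn: "norm (Y n) \<le> y n" for n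
  proof (induction n)
    case (Suc n)
    have "norm (T + (Y n o\<^sub>L Y n)) \<le> norm T + norm (Y n) * norm (Y n)"
      by (rule order_trans[OF norm_triangle_ineq]) (simp add: norm_blinfun_compose)
    also have "\<dots> \<le> 1 + y n * y n"
      using T Suc by (intro add_mono mult_mono) (auto simp: y1)
    finally show ?case by (simp add: YS yS power2_eq_square)
  qed (simp add: Y0 y0)
  have step: "norm (Y (Suc n) - Y n) \<le> y (Suc n) - y n" for n
  proof (induction n)
    case 0
    then show ?case using T by (simp add: Y0 YS y0 yS)
  next
    case (Suc n)
    let ?D = "Y (Suc n) - Y n"
    have "Y (Suc (Suc n)) - Y (Suc n)
        = (1/2) *\<^sub>R ((Y (Suc n) o\<^sub>L Y (Suc n)) - (Y n o\<^sub>L Y n))"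
      unfolding YS[of "Suc n"] by (subst (3) YS) (simp add: scaleR_diff_right[symmetric])
    \<comment> \<open>This splitting of a difference of squares holds for noncommuting factors too.\<close>
    also have "(Y (Suc n) o\<^sub>L Y (Suc n)) - (Y n o\<^sub>L Y n) = (Y (Suc n) o\<^sub>L ?D) + (?D o\<^sub>L Y n)"
      by (simp add: comp.diff_left comp.diff_right)
    finally have "norm (Y (Suc (Suc n)) - Y (Suc n)) = norm ((Y (Suc n) o\<^sub>L ?D) + (?D o\<^sub>L Y n)) / 2"
      by simp
    also have "\<dots> \<le> (norm (Y (Suc n)) * norm ?D + norm ?D * norm (Y n)) / 2"
      by (intro divide_right_mono order_trans[OF norm_triangle_ineq] add_mono norm_blinfun_compose) auto
    also have "\<dots> \<le> (y (Suc n) * (y (Suc n) - y n) + (y (Suc n) - y n) * y n) / 2"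
      using Suc Yn y1 order_trans[OF norm_ge_zero Suc]
      by (intro divide_right_mono add_mono mult_mono) auto
    also have "\<dots> = (1 + (y (Suc n))\<^sup>2) / 2 - (1 + (y n)\<^sup>2) / 2"
      by (simp add: power2_eq_square field_simps)
    also have "\<dots> = y (Suc (Suc n)) - y (Suc n)"
      by (simp only: yS[of "Suc n", symmetric] yS[of n, symmetric])
    finally show ?case .
  qed
  have inc: "incseq y"
    using step by (intro incseq_SucI) (meson diff_ge_0_iff_ge norm_ge_zero order_trans)
  have diff: "norm (Y (m + k) - Y m) \<le> y (m + k) - y m" for m k
  proof (induction k)
    case (Suc k)
    have "norm (Y (m + Suc k) - Y m)
        \<le> norm (Y (Suc (m + k)) - Y (m + k)) + norm (Y (m + k) - Y m)"
      by (rule order_trans[OF _ norm_triangle_ineq]) simp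
    with Suc step[of "m + k"] show ?case by simp
  qed simp
  have "convergent y"
    using inc y1 by (metis incseq_convergent convergentI)
  then have "Cauchy y" by (rule convergent_Cauchy)
  have "Cauchy Y"
  proof (rule CauchyI)
    fix e :: real assume "e > 0"
    from CauchyD[OF \<open>Cauchy y\<close> this] obtain M where
      M: "\<And>m n. m \<ge> M \<Longrightarrow> n \<ge> M \<Longrightarrow> norm (y m - y n) < e"
      by blast
    have le: "norm (Y n - Y m) < e" if "m \<ge> M" "m \<le> n" for m n
      using diff[of m "n - m"] M[of n m] that by auto
    show "\<exists>M. \<forall>m\<ge>M. \<forall>n\<ge>M. norm (Y m - Y n) < e"
      by (metis le nle_le norm_minus_commute)
  qed
  then obtain L where L: "Y \<longlonglongrightarrow> L"
    using Cauchy_convergent_iff convergent_def by blast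
  show ?thesis
  proof
    show "norm L \<le> 1"
      using L Yn y1 by (intro LIMSEQ_le_const2[OF tendsto_norm[OF L]]) (meson order_trans)
    have "(\<lambda>n. Y (Suc n)) \<longlonglongrightarrow> (1/2) *\<^sub>R (T + (L o\<^sub>L L))"
      unfolding YS by (intro tendsto_intros L comp.tendsto)
    then show "L = (1/2) *\<^sub>R (T + (L o\<^sub>L L))"
      using LIMSEQ_Suc[OF L] LIMSEQ_unique by blast
    show "\<forall>C. closed C \<longrightarrow> 0 \<in> C \<longrightarrow> (\<forall>Z\<in>C. (1/2) *\<^sub>R (T + (Z o\<^sub>L Z)) \<in> C) \<longrightarrow> L \<in> C"
    proof (intro allI impI)
      fix C :: "('b \<Rightarrow>\<^sub>L 'b) set"
      assume "closed C" "0 \<in> C" and step: "\<forall>Z\<in>C. (1/2) *\<^sub>R (T + (Z o\<^sub>L Z)) \<in> C"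
      have "Y n \<in> C" for n
        by (induction n) (simp_all only: Y0 YS \<open>0 \<in> C\<close> bspec[OF step])
      with \<open>closed C\<close> L show "L \<in> C"
        using closed_sequentially by blast
    qed
  qed
qed

context hilbert_space
begin

lemma quadratic_form_le_bound:
  assumes "\<And>x. norm (W x) \<le> K * norm x"
  shows "real_ip (W x) x \<le> K * (norm x)\<^sup>2"
  using real_ip_le_norm[of "W x" x] mult_right_mono[OF assms[of x] norm_ge_zero[of x]]
  by (simp add: power2_eq_square algebra_simps)

text \<open>
If \<open>W\<close> is bounded by \<open>K\<close>, then \<open>T = 1 - W / K\<close> is a positive semidefinite contraction and
\<open>sqrt K *\<^sub>R (1 - Y)\<close> with \<open>Y\<close> from \<open>sqrt_iteration\<close> is a square root of \<open>W\<close>. Being symmetric and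
commuting with a given operator that commutes with \<open>W\<close> are closed properties preserved by the
iteration, so \<open>Y\<close> has both; commutation is what uniqueness needs, and applied to scalar multiplication it makes the root
linear over the scalar field.
\<close>

lemma psd_sqrt_exists:
  assumes W: "positive_semidefinite W"
  obtains S where "positive_semidefinite S" "S \<circ> S = W"
    "\<And>B x. \<lbrakk>bounded_linear B; \<And>x. B (W x) = W (B x)\<rbrakk> \<Longrightarrow> B (S x) = S (B x)"
proof -
  have W_scale: "\<And>c x. W (scale c x) = scale c (W x)" and Wsym: "\<And>x y. ip (W x) y = ip x (W y)"
    using W by (simp_all add: positive_semidefinite_def endo_bounded_ops_iff)
  interpret W: bounded_linear W by (rule psd_bounded_linear[OF W])
  obtain K where "K > 0" and K: "\<And>x. norm (W x) \<le> K * norm x"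
    using W.pos_bounded by (auto simp: mult.commute)
  define T where "T x = x - (1/K) *\<^sub>R W x" for x
  have "bounded_linear T"
    unfolding T_def by (intro bounded_linear_sub bounded_linear_ident
      bounded_linear_compose[OF bounded_linear_scaleR_right] W.bounded_linear_axioms)
  then interpret T: bounded_linear T .
  have T_real_ip: "real_ip (T x) x = (norm x)\<^sup>2 - real_ip (W x) x / K" for x
    by (simp add: T_def real_ip_simps real_ip_self)
  have W_le: "real_ip (W x) x \<le> K * (norm x)\<^sup>2" for x
    by (rule quadratic_form_le_bound[OF K])
  have T_ip: "ip (T x) x = of_real (real_ip (T x) x)" for x
  proof -
    obtain r where "ip (W x) x = of_real r"
      using W unfolding positive_semidefinite_def by blast
    then have "ip (T x) x = of_real ((norm x)\<^sup>2 - r / K)"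
      by (simp add: T_def ip_diff_left ip_scaleR_left ip_self)
    then show ?thesis using ip_eq_of_real_real_ip by metis
  qed
  have T_sym: "ip (T x) y = ip x (T y)" for x y
    by (simp add: T_def ip_diff_left ip_diff_right ip_scaleR_left ip_scaleR_right Wsym)
  have "T \<in> bounded_ops scale scale"
    using \<open>bounded_linear T\<close> unfolding endo_bounded_ops_iff
    by (simp add: T_def scale_right_diff_distrib W_scale scale_of_real[symmetric]
        scale_left_commute)
  moreover have "real_ip (T x) x \<ge> 0" for x
    using W_le[of x] \<open>K > 0\<close> by (simp add: T_real_ip field_simps)
  ultimately have "positive_semidefinite T"
    using T_sym T_ip unfolding positive_semidefinite_def by blast
  then have "norm (T x) \<le> norm x" for x
    using psd_real_ip_nonneg[OF W] \<open>K > 0\<close> by (intro psd_contraction) (simp_all add: T_real_ip)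
  then have "norm (Blinfun T) \<le> 1"
    by (intro norm_blinfun_bound) (simp_all add: bounded_linear_Blinfun_apply T.bounded_linear_axioms)
  from sqrt_iteration[OF this] obtain Y where Y1: "norm Y \<le> 1"
    and YY: "Y = (1/2) *\<^sub>R (Blinfun T + (Y o\<^sub>L Y))"
    and Y_ind: "\<forall>C. closed C \<longrightarrow> 0 \<in> C
      \<longrightarrow> (\<forall>Z\<in>C. (1/2) *\<^sub>R (Blinfun T + (Z o\<^sub>L Z)) \<in> C) \<longrightarrow> Y \<in> C"
    .
  have Yc: "Y \<in> C"
    if "closed C" "0 \<in> C" "\<And>Z. Z \<in> C \<Longrightarrow> (1/2) *\<^sub>R (Blinfun T + (Z o\<^sub>L Z)) \<in> C" for C
    using Y_ind that by blast
  note [simp] = bounded_linear_Blinfun_apply[OF T.bounded_linear_axioms]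
  have Y_comm: "B (Y x) = Y (B x)" if B: "bounded_linear B" and BT: "\<And>x. B (W x) = W (B x)" for B x
  proof -
    interpret B: bounded_linear B by (rule B)
    have "Y \<in> {Z. \<forall>x. B (blinfun_apply Z x) = Z (B x)}"
    proof (rule Yc)
      show "closed {Z. \<forall>x. B (blinfun_apply Z x) = Z (B x)}"
        by (intro closed_Collect_all closed_Collect_eq continuous_intros
            B.continuous_on bounded_linear.continuous_on[OF blinfun.bounded_linear_left])
      show "(1/2) *\<^sub>R (Blinfun T + (Z o\<^sub>L Z)) \<in> {Z. \<forall>x. B (blinfun_apply Z x) = Z (B x)}"
        if "Z \<in> {Z. \<forall>x. B (blinfun_apply Z x) = Z (B x)}" for Z
        using that by (auto simp: blinfun.bilinear_simps B.scaleR B.add T_def B.diff BT)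
    qed (simp add: B.zero)
    then show ?thesis by simp
  qed
  have Y_sym: "ip (Y x) y = ip x (Y y)" for x y
  proof -
    have "Y \<in> {Z. \<forall>x y. ip (blinfun_apply Z x) y = ip x (Z y)}"
    proof (rule Yc)
      show "closed {Z. \<forall>x y. ip (blinfun_apply Z x) y = ip x (Z y)}"
        by (intro closed_Collect_all closed_Collect_eq continuous_intros
            bounded_linear.continuous_on[OF bounded_linear_ip_left]
            bounded_linear.continuous_on[OF bounded_linear_ip_right]
            bounded_linear.continuous_on[OF blinfun.bounded_linear_left])
      show "(1/2) *\<^sub>R (Blinfun T + (Z o\<^sub>L Z)) \<in> {Z. \<forall>x y. ip (blinfun_apply Z x) y = ip x (Z y)}"
        if "Z \<in> {Z. \<forall>x y. ip (blinfun_apply Z x) y = ip x (Z y)}" for Z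
        using that by (simp add: blinfun.bilinear_simps ip_add_left ip_add_right ip_scaleR_left
            ip_scaleR_right T_sym)
    qed simp
    then show ?thesis by simp
  qed
  define S where "S x = sqrt K *\<^sub>R (x - Y x)" for x
  have S_lin: "bounded_linear S"
    unfolding S_def
    by (intro bounded_linear_compose[OF bounded_linear_scaleR_right] bounded_linear_sub
        bounded_linear_ident blinfun.bounded_linear_right)
  have S_comm: "B (S x) = S (B x)" if B: "bounded_linear B" and BT: "\<And>x. B (W x) = W (B x)" for B x
    by (simp add: S_def linear_simps(2,5)[OF B] Y_comm[OF B BT])
  have "S \<in> bounded_ops scale scale"
    using S_lin S_comm[OF bounded_linear_scale] by (simp add: endo_bounded_ops_iff W_scale)
  moreover have S_sym: "ip (S x) y = ip x (S y)" for x y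
    by (simp add: S_def ip_scaleR_left ip_scaleR_right ip_diff_left ip_diff_right Y_sym)
  moreover have "\<exists>r\<ge>0. ip (S x) x = of_real r" for x
  proof (intro exI conjI)
    have "norm (Y x) \<le> 1 * norm x"
      by (rule order_trans[OF norm_blinfun]) (rule mult_right_mono[OF Y1 norm_ge_zero])
    then have "norm (Y x) * norm x \<le> norm x * norm x" by (intro mult_right_mono) auto
    with real_ip_le_norm[of "Y x" x] have "real_ip (Y x) x \<le> (norm x)\<^sup>2"
      by (simp add: power2_eq_square)
    then show "real_ip (S x) x \<ge> 0"
      using \<open>K > 0\<close> by (simp add: S_def real_ip_simps real_ip_self)
    have "of_real 2 * ip (S x) x = ip (S x) x + ip x (S x)" by (simp add: S_sym)
    also have "\<dots> = of_real (2 * real_ip (S x) x)" by (rule of_real_real_ip[symmetric])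
    finally show "ip (S x) x = of_real (real_ip (S x) x)" by simp
  qed
  ultimately have psd: "positive_semidefinite S" unfolding positive_semidefinite_def by blast
  have "S (S x) = W x" for x
  proof -
    have "2 *\<^sub>R Y x = T x + Y (Y x)"
      by (subst YY) (simp add: blinfun.bilinear_simps)
    then have "x - Y x - Y (x - Y x) = (1/K) *\<^sub>R W x"
      by (simp add: T_def blinfun.bilinear_simps algebra_simps scaleR_2)
    moreover have "S (S x) = K *\<^sub>R (x - Y x - Y (x - Y x))"
      using \<open>K > 0\<close> by (simp add: S_def blinfun.bilinear_simps scaleR_diff_right[symmetric])
    ultimately show ?thesis using \<open>K > 0\<close> by simp
  qed
  then have "S \<circ> S = W" by auto
  with psd show ?thesis using S_comm by (rule that)
qed

text \<open>
For \<open>y = S x - P x\<close> commutation gives \<open>(S + P) y = (S\<^sup>2 - P\<^sup>2) x = 0\<close>. Both forms are nonnegative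
at \<open>y\<close> and their sum is \<open>0\<close>, so \<open>S y = P y = 0\<close>, and symmetry turns this into \<open>norm y = 0\<close>.
\<close>

lemma psd_sqrt_unique:
  assumes S: "positive_semidefinite S" and P: "positive_semidefinite P"
    and comm: "\<And>x. P (S x) = S (P x)" and sq: "\<And>x. P (P x) = S (S x)"
  shows "P = S"
proof
  fix x
  interpret S: bounded_linear S
    by (rule psd_bounded_linear[OF S])
  interpret P: bounded_linear P
    by (rule psd_bounded_linear[OF P])
  define y where "y = S x - P x"
  have "S y + P y = 0" by (simp add: y_def S.diff P.diff comm sq)
  then have "real_ip (S y) y + real_ip (P y) y = 0"
    using real_ip_scaleR_left[of 0 0 y] by (simp flip: real_ip_add_left)
  with psd_real_ip_nonneg[OF S, of y] psd_real_ip_nonneg[OF P, of y]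
  have "real_ip (S y) y = 0" "real_ip (P y) y = 0" by linarith+
  then have "S y = 0" "P y = 0" using psd_kernel S P by blast+
  have "(norm y)\<^sup>2 = real_ip (S x - P x) y" by (simp add: real_ip_self[symmetric] y_def)
  also have "\<dots> = real_ip x (S y) - real_ip x (P y)"
    by (simp add: real_ip_simps psd_real_ip_symmetric[OF S] psd_real_ip_symmetric[OF P])
  also have "\<dots> = 0" by (simp add: \<open>S y = 0\<close> \<open>P y = 0\<close>)
  finally show "P x = S x" by (simp add: y_def)
qed

text \<open>
A positive semidefinite \<open>P\<close> with \<open>P \<circ> P = W\<close> commutes with \<open>W\<close>, hence with the root \<open>S\<close> of
\<open>psd_sqrt_exists\<close>, and thus equals it.
\<close>

lemma sqrt_op_spec:
  assumes W: "positive_semidefinite W"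
  shows psd_sqrt_op: "positive_semidefinite (sqrt_op W)"
    and sqrt_op_sqrt_op: "sqrt_op W (sqrt_op W x) = W x"
proof -
  obtain S where S: "positive_semidefinite S" "S \<circ> S = W"
    and comm: "\<And>B x. \<lbrakk>bounded_linear B; \<And>x. B (W x) = W (B x)\<rbrakk> \<Longrightarrow> B (S x) = S (B x)"
    using psd_sqrt_exists[OF W] by blast
  have uniq: "P = S" if P: "positive_semidefinite P" "P \<circ> P = W" for P
  proof (rule psd_sqrt_unique[OF S(1) P(1)])
    have "bounded_linear P"
      by (rule psd_bounded_linear[OF P(1)])
    then show "P (S x) = S (P x)" for x
      by (rule comm) (simp add: P(2)[symmetric])
    show "P (P x) = S (S x)" for x using P(2) S(2) by (metis comp_apply)
  qed
  have "sqrt_op W = S"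
    unfolding sqrt_op_def by (rule the_equality) (use S uniq in blast)+
  then show "positive_semidefinite (sqrt_op W)" "sqrt_op W (sqrt_op W x) = W x"
    using S(1) by (simp_all add: S(2)[symmetric])
qed

lemma sqrt_op_eq_0D:
  assumes "positive_semidefinite W" "sqrt_op W x = 0"
  shows "W x = 0"
proof -
  interpret bounded_linear "sqrt_op W"
    by (rule psd_bounded_linear[OF psd_sqrt_op[OF assms(1)]])
  show ?thesis using sqrt_op_sqrt_op[OF assms(1), of x] assms(2) by (simp add: zero)
qed

end

section \<open>Orthonormal sets and orthonormal bases\<close>

lemma has_sum_finite_sum:
  fixes g :: "'e \<Rightarrow> 'f \<Rightarrow> real"
  assumes "\<And>e. (g e has_sum s e) B"
  shows "((\<lambda>f. \<Sum>e\<in>E. g e f) has_sum (\<Sum>e\<in>E. s e)) B"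
  by (induction E rule: infinite_finite_induct) (auto intro: has_sum_add assms)

context hilbert_space
begin

definition orthonormal :: "'h set \<Rightarrow> bool"
  where "orthonormal E \<longleftrightarrow> (\<forall>e\<in>E. norm e = 1) \<and> pairwise (\<lambda>x y. ip x y = 0) E"

lemma orthonormal_ip: "\<lbrakk>orthonormal E; e \<in> E; f \<in> E\<rbrakk> \<Longrightarrow> ip e f = (if e = f then 1 else 0)"
  by (auto simp: orthonormal_def pairwise_def ip_self)

lemma orthonormal_subset: "orthonormal E \<Longrightarrow> F \<subseteq> E \<Longrightarrow> orthonormal F"
  by (auto simp: orthonormal_def pairwise_def)

lemma orthonormal_basis_iff: "orthonormal_basis E \<longleftrightarrow> orthonormal E \<and> closure (span E) = UNIV"
  by (auto simp: orthonormal_basis_def orthonormal_def)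

lemma norm_diff_scale_unit:
  assumes e: "norm e = 1"
  shows "(norm (v - scale c e))\<^sup>2 = (norm v)\<^sup>2 - (norm (ip v e))\<^sup>2 + (norm (ip v e - c))\<^sup>2"
proof -
  let ?a = "ip v e"
  have ee: "ip e e = 1" using e by (simp add: ip_self)
  have ev: "ip e v = kcnj ?a" by (rule ip_commute)
  have "of_real ((norm (v - scale c e))\<^sup>2) = ip (v - scale c e) (v - scale c e)"
    by (simp only: ip_self)
  also have "\<dots> = ip v v - ?a * kcnj ?a + (?a - c) * kcnj (?a - c)"
    by (simp add: ip_diff_left ip_diff_right ip_scale_left ip_scale_right ee ev kcnj_diff
        algebra_simps)
  also have "\<dots> = of_real ((norm v)\<^sup>2 - (norm ?a)\<^sup>2 + (norm (?a - c))\<^sup>2)"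
    by (simp only: mult_kcnj_of_real ip_self of_real_add of_real_diff)
  finally show ?thesis by (simp only: of_real_eq_iff)
qed

text \<open>
Completing the square for all coefficients \<open>c\<close> at once. The choices \<open>v = 0\<close> and \<open>c = ip v\<close> give the
norm of an orthonormal sum and Bessel's inequality; a general \<open>c\<close> compares \<open>v\<close> with an arbitrary
element of the span.
\<close>

lemma norm_diff_orthonormal_sum:
  assumes "finite F" "orthonormal F"
  shows "(norm (v - (\<Sum>f\<in>F. scale (c f) f)))\<^sup>2
    = (norm v)\<^sup>2 - (\<Sum>f\<in>F. (norm (ip v f))\<^sup>2) + (\<Sum>f\<in>F. (norm (ip v f - c f))\<^sup>2)"
  using assms
proof (induction F)
  case (insert e F)
  define w where "w = v - (\<Sum>f\<in>F. scale (c f) f)"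
  have on: "orthonormal F" using insert.prems by (rule orthonormal_subset) auto
  have "ip (\<Sum>f\<in>F. scale (c f) f) e = (\<Sum>f\<in>F. c f * ip f e)"
    by (simp add: ip_sum_left ip_scale_left)
  also have "\<dots> = 0"
    using insert.hyps by (intro sum.neutral) (auto simp: orthonormal_ip[OF insert.prems])
  finally have we: "ip w e = ip v e" by (simp add: w_def ip_diff_left)
  have "norm e = 1" using insert.prems by (simp add: orthonormal_def)
  from norm_diff_scale_unit[OF this, of w "c e"]
  have step: "(norm (w - scale (c e) e))\<^sup>2 = (norm w)\<^sup>2 - (norm (ip v e))\<^sup>2 + (norm (ip v e - c e))\<^sup>2"
    by (simp only: we)
  have eq: "v - (\<Sum>f\<in>insert e F. scale (c f) f) = w - scale (c e) e"
    using insert.hyps by (simp add: w_def algebra_simps)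
  show ?case
    unfolding eq step using insert.IH[OF on] insert.hyps by (simp add: w_def)
qed simp

lemma norm_orthonormal_sum:
  assumes "finite F" "orthonormal F"
  shows "(norm (\<Sum>f\<in>F. scale (c f) f))\<^sup>2 = (\<Sum>f\<in>F. (norm (c f))\<^sup>2)"
  using norm_diff_orthonormal_sum[OF assms, of 0 c] by simp

lemma Bessel_inequality:
  assumes "finite F" "orthonormal F"
  shows "(\<Sum>f\<in>F. (norm (ip v f))\<^sup>2) \<le> (norm v)\<^sup>2"
  using norm_diff_orthonormal_sum[OF assms, of v "ip v"]
    zero_le_power2[of "norm (v - (\<Sum>f\<in>F. scale (ip v f) f))"]
  by simp

lemma Bessel_summable:
  assumes "orthonormal E"
  shows "(\<lambda>f. (norm (ip v f))\<^sup>2) summable_on E"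
proof (rule nonneg_bdd_above_summable_on)
  show "bdd_above (sum (\<lambda>f. (norm (ip v f))\<^sup>2) ` {F. F \<subseteq> E \<and> finite F})"
    using Bessel_inequality orthonormal_subset[OF assms]
    by (intro bdd_aboveI[of _ "(norm v)\<^sup>2"]) auto
qed simp

text \<open>
An element \<open>u\<close> of the span that is close to \<open>v\<close> involves only a finite \<open>F \<subseteq> E\<close>, and
\<open>norm_diff_orthonormal_sum\<close> bounds the part of \<open>v\<close> not captured by \<open>F\<close> by the distance from \<open>v\<close> to \<open>u\<close>.
\<close>

lemma Parseval_inequality:
  assumes E: "orthonormal_basis E"
  shows "(norm v)\<^sup>2 \<le> (\<Sum>\<^sub>\<infinity>f\<in>E. (norm (ip v f))\<^sup>2)"
proof (rule field_le_epsilon)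
  fix d :: real assume "d > 0"
  have on: "orthonormal E" and "v \<in> closure (span E)"
    using E by (auto simp: orthonormal_basis_iff)
  then obtain u where u: "u \<in> span E" "dist u v < sqrt d"
    using \<open>d > 0\<close> by (metis closure_approachable real_sqrt_gt_0_iff)
  from u(1) obtain F c where F: "finite F" "F \<subseteq> E" "u = (\<Sum>f\<in>F. scale (c f) f)"
    unfolding span_explicit by auto
  have "(norm v)\<^sup>2 - (\<Sum>f\<in>F. (norm (ip v f))\<^sup>2) \<le> (norm (v - u))\<^sup>2"
    using norm_diff_orthonormal_sum[OF F(1) orthonormal_subset[OF on F(2)], of v c]
    by (simp add: F(3) sum_nonneg)
  also have "\<dots> \<le> (sqrt d)\<^sup>2"
    using u(2) by (intro power_mono) (auto simp: dist_norm norm_minus_commute)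
  also have "\<dots> = d" using \<open>d > 0\<close> by simp
  finally have "(norm v)\<^sup>2 \<le> (\<Sum>f\<in>F. (norm (ip v f))\<^sup>2) + d" by simp
  also have "(\<Sum>f\<in>F. (norm (ip v f))\<^sup>2) \<le> (\<Sum>\<^sub>\<infinity>f\<in>E. (norm (ip v f))\<^sup>2)"
    by (rule finite_sum_le_infsum[OF Bessel_summable[OF on] F(1,2)]) simp
  finally show "(norm v)\<^sup>2 \<le> (\<Sum>\<^sub>\<infinity>f\<in>E. (norm (ip v f))\<^sup>2) + d" by simp
qed

lemma orthonormal_basis_total:
  assumes "orthonormal_basis E" "\<And>e. e \<in> E \<Longrightarrow> ip v e = 0"
  shows "v = 0"
proof -
  have "(\<Sum>\<^sub>\<infinity>f\<in>E. (norm (ip v f))\<^sup>2) = 0" using assms(2) by (intro infsum_0) auto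
  with Parseval_inequality[OF assms(1), of v] show ?thesis by simp
qed

lemma parallelogram:
  fixes u v :: 'h
  shows "(norm (u - v))\<^sup>2 = 2 * (norm u)\<^sup>2 + 2 * (norm v)\<^sup>2 - (norm (u + v))\<^sup>2"
  unfolding real_ip_self[symmetric] by (simp add: real_ip_simps real_ip_commute[of v u])

text \<open>
The perpendicular from \<open>x\<close> to the closed span. A sequence in the span that minimises the
distance to \<open>x\<close> is Cauchy by the parallelogram law. Its limit \<open>l\<close> realises the distance, and
\<open>z = x - l\<close> is orthogonal to each \<open>e\<close>, since otherwise subtracting \<open>scale (ip z e) e\<close> would shorten it.
\<close>

lemma exists_orthogonal_to_span:
  assumes "x \<notin> closure (span E)" "\<And>e. e \<in> E \<Longrightarrow> norm e = 1"
  obtains z where "z \<noteq> 0" "\<And>e. e \<in> E \<Longrightarrow> ip z e = 0"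
proof -
  define D where "D = Inf ((\<lambda>m. (norm (x - m))\<^sup>2) ` span E)"
  have D_le: "D \<le> (norm (x - m))\<^sup>2" if "m \<in> span E" for m
    unfolding D_def using that by (intro cInf_lower bdd_belowI[of _ 0]) auto
  have "\<exists>m\<in>span E. (norm (x - m))\<^sup>2 < D + 1 / real (Suc n)" for n
    using cInf_lessD[of "(\<lambda>m. (norm (x - m))\<^sup>2) ` span E" "D + 1 / real (Suc n)"] span_zero
    by (auto simp: D_def)
  then obtain m where m: "\<And>n. m n \<in> span E" and mD: "\<And>n. (norm (x - m n))\<^sup>2 < D + 1 / real (Suc n)"
    by metis
  have close: "(norm (m i - m j))\<^sup>2 \<le> 2 / real (Suc i) + 2 / real (Suc j)" for i j
  proof -
    have "(1/2) *\<^sub>R (m i + m j) \<in> span E"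
      unfolding scale_of_real[symmetric] by (intro span_scale span_add m)
    then have "D \<le> (norm (x - (1/2) *\<^sub>R (m i + m j)))\<^sup>2" by (rule D_le)
    also have "x - (1/2) *\<^sub>R (m i + m j) = (1/2) *\<^sub>R ((x - m i) + (x - m j))"
      by (simp add: algebra_simps flip: scaleR_add_left)
    also have "(norm \<dots>)\<^sup>2 = (norm ((x - m i) + (x - m j)))\<^sup>2 / 4"
      by (simp add: power_divide)
    finally have "4 * D \<le> (norm ((x - m i) + (x - m j)))\<^sup>2" by simp
    with parallelogram[of "x - m j" "x - m i"] mD[of i] mD[of j] show ?thesis
      by (simp add: add.commute)
  qed
  have "Cauchy m"
  proof (rule CauchyI)
    fix e :: real assume "e > 0"
    then obtain M where M: "4 / e\<^sup>2 < real M" using reals_Archimedean2 by blast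
    have "norm (m i - m j) < e" if "i \<ge> M" "j \<ge> M" for i j
    proof -
      have "real M > 0" using M \<open>e > 0\<close> by (smt (verit) divide_nonneg_nonneg zero_le_power2)
      have "(norm (m i - m j))\<^sup>2 \<le> 2 / real (Suc i) + 2 / real (Suc j)" by (rule close)
      also have "\<dots> \<le> 2 / real M + 2 / real M"
        using that \<open>real M > 0\<close> by (intro add_mono divide_left_mono) auto
      also have "\<dots> < e\<^sup>2" using M \<open>e > 0\<close> \<open>real M > 0\<close> by (simp add: field_simps)
      finally show ?thesis using \<open>e > 0\<close> by (simp add: power2_less_imp_less)
    qed
    then show "\<exists>M. \<forall>i\<ge>M. \<forall>j\<ge>M. norm (m i - m j) < e" by blast
  qed
  then obtain l where l: "m \<longlonglongrightarrow> l" using Cauchy_convergent_iff convergent_def by blast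
  define z where "z = x - l"
  have "l \<in> closure (span E)" using l m closure_sequential by blast
  then have "z \<noteq> 0" using assms(1) by (auto simp: z_def)
  have "(\<lambda>n. D + 1 / real (Suc n)) \<longlonglongrightarrow> D + 0"
    by (intro tendsto_intros LIMSEQ_Suc[OF lim_1_over_n])
  then have "(norm z)\<^sup>2 \<le> D + 0"
    unfolding z_def using mD
    by (intro LIMSEQ_le[of "\<lambda>n. (norm (x - m n))\<^sup>2"] tendsto_intros l) (auto intro: less_imp_le)
  moreover have "D \<le> (norm (z - scale c e))\<^sup>2" if "e \<in> E" for c e
  proof (rule LIMSEQ_le_const)
    show "(\<lambda>n. (norm (x - m n - scale c e))\<^sup>2) \<longlonglongrightarrow> (norm (z - scale c e))\<^sup>2"
      unfolding z_def by (intro tendsto_intros l)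
    show "\<exists>N. \<forall>n\<ge>N. D \<le> (norm (x - m n - scale c e))\<^sup>2"
      using D_le[of "m n + scale c e" for n] that m
      by (auto simp: span_add span_scale span_base diff_diff_eq)
  qed
  ultimately have z_le: "(norm z)\<^sup>2 \<le> (norm (z - scale (ip z e) e))\<^sup>2" if "e \<in> E" for e
    using that by (metis add.right_neutral order_trans)
  then have "ip z e = 0" if "e \<in> E" for e
    using norm_diff_scale_unit[OF assms(2)[OF that], of z "ip z e"] z_le[OF that]
    by (simp del: power_mono_iff abs_le_square_iff)
  with \<open>z \<noteq> 0\<close> show ?thesis by (rule that)
qed

text \<open>
A maximal orthonormal set has dense span, as a vector orthogonal to it could be normalised and added.
\<close>

lemma orthonormal_basis_exists: "\<exists>E. orthonormal_basis E"
proof -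
  have "\<exists>M\<in>{E. orthonormal E}. \<forall>X\<in>{E. orthonormal E}. M \<subseteq> X \<longrightarrow> X = M"
  proof (rule subset_Zorn')
    fix C assume "subset.chain {E. orthonormal E} C"
    then have C: "C \<subseteq> {E. orthonormal E}" "\<And>X Y. \<lbrakk>X \<in> C; Y \<in> C\<rbrakk> \<Longrightarrow> X \<subseteq> Y \<or> Y \<subseteq> X"
      by (auto simp: subset_chain_def)
    show "\<Union>C \<in> {E. orthonormal E}"
      using C by (auto simp: orthonormal_def chain_subset_def intro!: pairwise_chain_Union)
  qed
  then obtain E where E: "orthonormal E" and max: "\<And>X. orthonormal X \<Longrightarrow> E \<subseteq> X \<Longrightarrow> X = E"
    by auto
  have "closure (span E) = UNIV"
  proof (rule ccontr)
    assume "closure (span E) \<noteq> UNIV"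
    then obtain x where "x \<notin> closure (span E)" by auto
    then obtain z where z: "z \<noteq> 0" "\<And>e. e \<in> E \<Longrightarrow> ip z e = 0"
      using exists_orthogonal_to_span E unfolding orthonormal_def by metis
    define u where "u = (1 / norm z) *\<^sub>R z"
    have u: "norm u = 1" "\<And>e. e \<in> E \<Longrightarrow> ip u e = 0" "\<And>e. e \<in> E \<Longrightarrow> ip e u = 0"
      using z ip_commute[of _ z] by (auto simp: u_def ip_scaleR_left ip_scaleR_right)
    have "orthonormal (insert u E)"
      using E u by (auto simp: orthonormal_def pairwise_insert)
    then have "u \<in> E" using max by blast
    with u(2)[of u] u(1) show False by (simp add: ip_self)
  qed
  with E show ?thesis by (auto simp: orthonormal_basis_iff)
qed

text \<open>
The orthogonal projection of \<open>v\<close> to the span of a finite orthonormal basis is a finite sum, and it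
equals \<open>v\<close> because the remainder is orthogonal to the basis.
\<close>

lemma finite_orthonormal_basis_imp_finite_dim:
  assumes E: "orthonormal_basis E" and fin: "finite E"
  shows finite_dim
proof -
  have on: "orthonormal E" using E by (simp add: orthonormal_basis_iff)
  have "v \<in> span E" for v
  proof -
    define u where "u = (\<Sum>f\<in>E. scale (ip v f) f)"
    have "v - u = 0"
    proof (rule orthonormal_basis_total[OF E])
      fix e assume e: "e \<in> E"
      have "ip u e = (\<Sum>f\<in>E. ip v f * ip f e)" by (simp add: u_def ip_sum_left ip_scale_left)
      also have "\<dots> = (\<Sum>f\<in>E. if f = e then ip v f else 0)"
        using e by (intro sum.cong) (auto simp: orthonormal_ip[OF on])
      also have "\<dots> = ip v e" using e fin by simp
      finally show "ip (v - u) e = 0" by (simp add: ip_diff_left)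
    qed
    moreover have "u \<in> span E" unfolding u_def by (intro span_sum span_scale span_base)
    ultimately show ?thesis by simp
  qed
  then show ?thesis unfolding finite_dim_def using fin by blast
qed

end

section \<open>Hilbert-Schmidt operators\<close>

text \<open>
Bessel's inequality for the vector \<open>D\<^sup>* v\<close>, proved without the adjoint: \<open>u\<close> below is the
projection of \<open>D\<^sup>* v\<close> to the span of \<open>E\<close>, and the inner product of \<open>D u\<close> with \<open>v\<close> is its squared norm.
\<close>

lemma Bessel_bounded_op:
  assumes "hilbert_space sH ipH" "hilbert_space sF ipF" "D \<in> bounded_ops sH sF"
    and K: "\<And>x. norm (D x) \<le> K * norm x" and "K \<ge> 0"
    and E: "finite E" "hilbert_space.orthonormal ipH E"
  shows "(\<Sum>e\<in>E. (norm (ipF (D e) v))\<^sup>2) \<le> K\<^sup>2 * (norm v)\<^sup>2"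
proof -
  interpret H: hilbert_space sH ipH by fact
  interpret F: hilbert_space sF ipF by fact
  have D: "bounded_linear D" "\<And>c x. D (sH c x) = sF c (D x)"
    using assms(3) by (simp_all add: bounded_ops_iff[OF assms(1,2)])
  interpret D: bounded_linear D by (rule D)
  define s where "s = (\<Sum>e\<in>E. (norm (ipF (D e) v))\<^sup>2)"
  define u where "u = (\<Sum>e\<in>E. sH (kcnj (ipF (D e) v)) e)"
  have "s \<ge> 0" by (simp add: s_def sum_nonneg)
  have u: "(norm u)\<^sup>2 = s"
    unfolding u_def s_def by (subst H.norm_orthonormal_sum[OF E]) simp
  have "ipF (D u) v = of_real s"
    by (simp add: u_def s_def D.sum D(2) F.ip_sum_left F.ip_scale_left mult_kcnj_of_real
        mult.commute[of "kcnj _"] del: of_real_power)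
  then have "s = norm (ipF (D u) v)" using \<open>s \<ge> 0\<close> by simp
  also have "\<dots> \<le> norm (D u) * norm v" by (rule F.Cauchy_Schwarz)
  also have "\<dots> \<le> K * norm u * norm v" by (intro mult_right_mono K) simp
  finally have "s\<^sup>2 \<le> (K * norm u * norm v)\<^sup>2" using \<open>s \<ge> 0\<close> by (intro power_mono)
  also have "\<dots> = s * (K\<^sup>2 * (norm v)\<^sup>2)" by (simp add: power_mult_distrib u)
  finally have "s * s \<le> s * (K\<^sup>2 * (norm v)\<^sup>2)" by (simp add: power2_eq_square)
  then have "s \<le> K\<^sup>2 * (norm v)\<^sup>2"
    using \<open>s \<ge> 0\<close> by (cases "s = 0") auto
  then show ?thesis by (simp add: s_def)
qed

text \<open>
Expand each \<open>S (D e)\<close> in a basis \<open>B\<close> of the codomain on which \<open>S\<close> is square summable, move \<open>S\<close> to the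
other side by symmetry, and sum over \<open>e\<close> first: by \<open>Bessel_bounded_op\<close> each \<open>f \<in> B\<close> contributes at
most \<open>K\<^sup>2 * (norm (S f))\<^sup>2\<close>. The bound is uniform in the finite subsets of \<open>E\<close>.
\<close>

lemma hilbert_schmidt_comp_summable:
  assumes "hilbert_space sH ipH" "hilbert_space sF ipF" "D \<in> bounded_ops sH sF"
    and S: "hilbert_space.positive_semidefinite sF ipF S"
      "S \<in> hilbert_space.hilbert_schmidt sF ipF sF"
    and E: "hilbert_space.orthonormal ipH E"
  shows "(\<lambda>e. (norm (S (D e)))\<^sup>2) summable_on E"
proof -
  interpret H: hilbert_space sH ipH by fact
  interpret F: hilbert_space sF ipF by fact
  interpret D: bounded_linear D using assms(3) by (simp add: bounded_ops_iff[OF assms(1,2)])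
  obtain K where K: "K \<ge> 0" "\<And>x. norm (D x) \<le> K * norm x"
    using D.nonneg_bounded by (auto simp: mult.commute)
  have S_sym: "ipF (S x) y = ipF x (S y)" for x y
    using S(1) by (auto simp: F.positive_semidefinite_def)
  from S(2) obtain B where B: "F.orthonormal_basis B" and sum: "(\<lambda>f. (norm (S f))\<^sup>2) summable_on B"
    by (auto simp: F.hilbert_schmidt_def)
  have B_on: "F.orthonormal B" using B by (simp add: F.orthonormal_basis_iff)
  let ?C = "K\<^sup>2 * (\<Sum>\<^sub>\<infinity>f\<in>B. (norm (S f))\<^sup>2)"
  have "(\<Sum>e\<in>E'. (norm (S (D e)))\<^sup>2) \<le> ?C" if E': "E' \<subseteq> E" "finite E'" for E'
  proof -
    have summ: "(\<lambda>f. (norm (ipF (S (D e)) f))\<^sup>2) summable_on B" for e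
      by (rule F.Bessel_summable[OF B_on])
    have "(\<Sum>e\<in>E'. (norm (S (D e)))\<^sup>2) \<le> (\<Sum>e\<in>E'. \<Sum>\<^sub>\<infinity>f\<in>B. (norm (ipF (S (D e)) f))\<^sup>2)"
      by (intro sum_mono F.Parseval_inequality[OF B])
    also have "\<dots> = (\<Sum>\<^sub>\<infinity>f\<in>B. \<Sum>e\<in>E'. (norm (ipF (S (D e)) f))\<^sup>2)"
      by (rule infsumI[symmetric], rule has_sum_finite_sum) (rule has_sum_infsum[OF summ])
    also have "\<dots> \<le> (\<Sum>\<^sub>\<infinity>f\<in>B. K\<^sup>2 * (norm (S f))\<^sup>2)"
    proof (rule infsum_mono)
      show "(\<lambda>f. \<Sum>e\<in>E'. (norm (ipF (S (D e)) f))\<^sup>2) summable_on B"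
        by (rule has_sum_imp_summable, rule has_sum_finite_sum) (rule has_sum_infsum[OF summ])
      show "(\<lambda>f. K\<^sup>2 * (norm (S f))\<^sup>2) summable_on B"
        by (rule summable_on_cmult_right[OF sum])
      show "(\<Sum>e\<in>E'. (norm (ipF (S (D e)) f))\<^sup>2) \<le> K\<^sup>2 * (norm (S f))\<^sup>2" for f
        unfolding S_sym using E' H.orthonormal_subset[OF E]
        by (intro Bessel_bounded_op[OF assms(1-3) K(2) K(1)]) auto
    qed
    also have "\<dots> = ?C" by (rule infsum_cmult_right') 
    finally show ?thesis .
  qed
  then show ?thesis
    by (intro nonneg_bdd_above_summable_on bdd_aboveI[of _ ?C]) auto
qed

section \<open>The infimum and its attainment\<close>

lemma summable_on_infinite_small_term:
  fixes f :: "'e \<Rightarrow> real"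
  assumes "f summable_on E" "infinite E" "\<And>e. e \<in> E \<Longrightarrow> f e \<ge> 0" "d > 0"
  shows "\<exists>e\<in>E. f e < d"
proof (rule ccontr)
  assume "\<not> (\<exists>e\<in>E. f e < d)"
  then have ge: "d \<le> f e" if "e \<in> E" for e using that by force
  obtain n where n: "infsum f E < real n * d"
    using reals_Archimedean3[OF \<open>d > 0\<close>] by blast
  obtain F where F: "finite F" "card F = n" "F \<subseteq> E"
    using infinite_arbitrarily_large[OF \<open>infinite E\<close>] by blast
  have "real n * d \<le> sum f F"
    using sum_bounded_below[of F d f] F ge by auto
  also have "\<dots> \<le> infsum f E"
    using F assms by (intro finite_sum_le_infsum) auto
  finally show False using n by simp
qed

lemma bounded_ops_eq_0_on_basis:
  assumes "hilbert_space sH ipH" "hilbert_space sF ipF" "T \<in> bounded_ops sH sF"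
    and E: "hilbert_space.orthonormal_basis sH ipH E" and "\<And>e. e \<in> E \<Longrightarrow> T e = 0"
  shows "T x = 0"
proof -
  interpret H: hilbert_space sH ipH by fact
  interpret F: hilbert_space sF ipF by fact
  have T: "bounded_linear T" "\<And>c x. T (sH c x) = sF c (T x)"
    using assms(3) by (simp_all add: bounded_ops_iff[OF assms(1,2)])
  interpret T: bounded_linear T by (rule T)
  have "T x = 0" if "x \<in> H.span E" for x
    using that by (induction rule: H.span_induct_alt) (simp_all add: T.zero T.add T(2) assms(5))
  then have "closure (H.span E) \<subseteq> {x. T x = 0}"
    by (intro closure_minimal closed_Collect_eq T.continuous_on continuous_intros) auto
  with E show ?thesis by (auto simp: H.orthonormal_basis_def)
qed

context hilbert_space
begin

text \<open>
An operator vanishing on all basis vectors but one has a norm that can be read off directly. This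
is why the competitor below is built from a vector of the very basis chosen in \<open>hs_norm\<close>.
\<close>

lemma hs_norm_rank_one:
  assumes "u \<in> (SOME E. orthonormal_basis E)"
    and "\<And>e. \<lbrakk>e \<in> (SOME E. orthonormal_basis E); e \<noteq> u\<rbrakk> \<Longrightarrow> X e = 0"
  shows "hs_norm X = norm (X u)"
proof -
  have "(\<Sum>\<^sub>\<infinity>e\<in>(SOME E. orthonormal_basis E). (norm (X e))\<^sup>2) = (\<Sum>\<^sub>\<infinity>e\<in>{u}. (norm (X e))\<^sup>2)"
    by (rule infsum_cong_neutral) (use assms in auto)
  then show ?thesis by (simp add: hs_norm_def)
qed

end

text \<open>
The infimum of the problem is \<open>0\<close>, in the stronger form that the equation \<open>X x = b\<close> holds exactly.
The dimension of the domain enters here: among infinitely many basis vectors there is an \<open>e\<close>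
that \<open>S A\<close> makes short. A finite basis may contain no such vector.
\<close>

lemma exact_solution_near_A:
  assumes H: "hilbert_space sH ipH" and F: "hilbert_space sF ipF"
    and A: "A \<in> bounded_ops sH sF"
    and W: "hilbert_space.positive_semidefinite sF ipF W"
    and HS: "hilbert_space.sqrt_op sF ipF W \<in> hilbert_space.hilbert_schmidt sF ipF sF"
    and inf_dim: "\<not> hilbert_space.finite_dim sH" and "d > 0"
  obtains X x where "X \<in> bounded_ops sH sF" "X x = b"
    "weighted_hs_norm sH ipH sF ipF W (\<lambda>h. A h - X h) < d"
proof -
  interpret H: hilbert_space sH ipH by fact
  interpret F: hilbert_space sF ipF by fact
  define S where "S = F.sqrt_op W"
  define E where "E = (SOME E. H.orthonormal_basis E)"
  have E: "H.orthonormal_basis E"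
    unfolding E_def by (rule someI_ex) (rule H.orthonormal_basis_exists)
  then have on: "H.orthonormal E" by (simp add: H.orthonormal_basis_iff)
  have "infinite E" using H.finite_orthonormal_basis_imp_finite_dim[OF E] inf_dim by blast
  have S: "F.positive_semidefinite S" unfolding S_def by (rule F.psd_sqrt_op[OF W])
  have S_scale: "S (sF c y) = sF c (S y)" for c y
    using S by (simp add: F.positive_semidefinite_def F.endo_bounded_ops_iff)
  interpret S: bounded_linear S by (rule F.psd_bounded_linear[OF S])
  have A': "bounded_linear A" "\<And>c x. A (sH c x) = sF c (A x)"
    using A by (simp_all add: bounded_ops_iff[OF H F])
  interpret A: bounded_linear A by (rule A')
  have "(\<lambda>e. (norm (S (A e)))\<^sup>2) summable_on E"
    by (rule hilbert_schmidt_comp_summable[OF H F A S _ on]) (use HS in \<open>simp add: S_def\<close>)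
  then obtain e where "e \<in> E" and e: "(norm (S (A e)))\<^sup>2 < (d / 2)\<^sup>2"
    using summable_on_infinite_small_term[of _ E "(d / 2)\<^sup>2"] \<open>infinite E\<close> \<open>d > 0\<close> by force
  have SAe: "norm (S (A e)) < d / 2" using e by (rule power2_less_imp_less) (use \<open>d > 0\<close> in simp)
  \<comment> \<open>The summand \<open>1\<close> keeps \<open>t\<close> positive when \<open>S b = 0\<close>.\<close>
  define t where "t = 2 * (norm (S b) + 1) / d"
  have t: "t > 0" "norm (S b) / t < d / 2"
    using \<open>d > 0\<close> norm_ge_zero[of "S b"]
    by (auto simp: t_def field_simps add_pos_nonneg intro: add_pos_nonneg)
  define x where "x = t *\<^sub>R e"
  define X where "X h = A h + sF (ipH h e / of_real t) (b - A x)" for h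
  have e_norm: "norm e = 1" using on \<open>e \<in> E\<close> by (simp add: H.orthonormal_def)
  have rank_one: "bounded_linear (\<lambda>h. sF (ipH h e / of_real t) y)" for y
  proof (rule bounded_linear_intro[where K = "norm y / t"])
    show "norm (sF (ipH h e / of_real t) y) \<le> norm h * (norm y / t)" for h
      using H.Cauchy_Schwarz[of h e] t(1) e_norm
      by (simp add: F.norm_scale norm_divide mult_right_mono divide_right_mono)
  qed (simp_all add: H.ip_add_left H.ip_scaleR_left add_divide_distrib F.scale_left_distrib
      flip: F.scale_of_real)
  have "X \<in> bounded_ops sH sF"
    unfolding bounded_ops_iff[OF H F] X_def
    by (intro conjI allI bounded_linear_add rank_one A'(1))
      (simp add: A'(2) H.ip_scale_left F.scale_right_distrib)
  moreover have "X x = b"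
    using t(1) e_norm by (simp add: X_def x_def H.ip_scaleR_left H.ip_self)
  moreover have "weighted_hs_norm sH ipH sF ipF W (\<lambda>h. A h - X h) < d"
  proof -
    have SD: "S (A h - X h) = - sF (ipH h e / of_real t) (S (b - A x))" for h
      by (simp add: X_def S.neg S_scale)
    have "weighted_hs_norm sH ipH sF ipF W (\<lambda>h. A h - X h) = norm (S (A e - X e))"
      unfolding weighted_hs_norm_def S_def[symmetric]
    proof (subst H.hs_norm_rank_one[of e])
      show "e \<in> (SOME E. H.orthonormal_basis E)" using \<open>e \<in> E\<close> by (simp add: E_def)
      show "(S \<circ> (\<lambda>h. A h - X h)) f = 0"
        if "f \<in> (SOME E. H.orthonormal_basis E)" "f \<noteq> e" for f
        using that \<open>e \<in> E\<close> H.orthonormal_ip[OF on, of f e] by (simp add: SD E_def)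
    qed simp
    also have "\<dots> = norm (S b - t *\<^sub>R S (A e)) / t"
      unfolding SD using t(1) e_norm
      by (simp add: F.norm_scale H.ip_self norm_divide x_def A.scaleR S.diff S.scaleR)
    also have "\<dots> \<le> (norm (S b) + t * norm (S (A e))) / t"
      using t(1) norm_triangle_ineq4[of "S b" "t *\<^sub>R S (A e)"] by (intro divide_right_mono) auto
    also have "\<dots> = norm (S b) / t + norm (S (A e))" using t(1) by (simp add: add_divide_distrib)
    also have "\<dots> < d" using t(2) SAe by linarith
    finally show ?thesis .
  qed
  ultimately show ?thesis by (rule that)
qed

theorem corollary3p3:
  fixes sH :: "'k::real_or_complex \<Rightarrow> 'h::banach \<Rightarrow> 'h" and ipH :: "'h \<Rightarrow> 'h \<Rightarrow> 'k"
    and sF :: "'k \<Rightarrow> 'f::banach \<Rightarrow> 'f" and ipF :: "'f \<Rightarrow> 'f \<Rightarrow> 'k"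
    and A :: "'h \<Rightarrow> 'f" and b :: 'f and W :: "'f \<Rightarrow> 'f"
  assumes "hilbert_space sH ipH" and "hilbert_space sF ipF"
    and "A \<in> bounded_ops sH sF"
    and "hilbert_space.positive_semidefinite sF ipF W"
    and "hilbert_space.sqrt_op sF ipF W \<in> hilbert_space.hilbert_schmidt sF ipF sF"
    and "b \<notin> {A x + z |x z. W z = 0}"
    and "\<not> hilbert_space.finite_dim sH"
  shows "\<not> (\<exists>p. is_arg_min
    (\<lambda>(X, x). (weighted_hs_norm sH ipH sF ipF W (\<lambda>h. A h - X h))\<^sup>2
             + (hilbert_space.weighted_norm sF ipF W (X x - b))\<^sup>2)
    (\<lambda>(X, x). X \<in> bounded_ops sH sF) p)"
proof
  let ?N = "weighted_hs_norm sH ipH sF ipF W"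
  let ?w = "hilbert_space.weighted_norm sF ipF W"
  interpret H: hilbert_space sH ipH by fact
  interpret F: hilbert_space sF ipF by fact
  define S where "S = F.sqrt_op W"
  have S: "F.positive_semidefinite S" unfolding S_def by (rule F.psd_sqrt_op[OF assms(4)])
  interpret S: bounded_linear S by (rule F.psd_bounded_linear[OF S])
  assume "\<exists>p. is_arg_min (\<lambda>(X, x). (?N (\<lambda>h. A h - X h))\<^sup>2 + (?w (X x - b))\<^sup>2)
    (\<lambda>(X, x). X \<in> bounded_ops sH sF) p"
  then obtain X x where X: "X \<in> bounded_ops sH sF" and min: "\<And>Y y. Y \<in> bounded_ops sH sF \<Longrightarrow>
      (?N (\<lambda>h. A h - X h))\<^sup>2 + (?w (X x - b))\<^sup>2 \<le> (?N (\<lambda>h. A h - Y h))\<^sup>2 + (?w (Y y - b))\<^sup>2"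
    by (force simp: is_arg_min_def not_less)
  define v where "v = (?N (\<lambda>h. A h - X h))\<^sup>2 + (?w (X x - b))\<^sup>2"
  have N_nonneg: "?N D \<ge> 0" for D
    by (simp add: weighted_hs_norm_def H.hs_norm_def infsum_nonneg)
  have "v = 0"
  proof (rule ccontr)
    assume "v \<noteq> 0"
    then have "v > 0" by (simp add: v_def order_less_le)
    then have "sqrt v > 0" by simp
    then obtain Y y where Y: "Y \<in> bounded_ops sH sF" "Y y = b" "?N (\<lambda>h. A h - Y h) < sqrt v"
      using exact_solution_near_A[OF assms(1-5) assms(7)] by blast
    have "v \<le> (?N (\<lambda>h. A h - Y h))\<^sup>2 + (?w (Y y - b))\<^sup>2"
      unfolding v_def by (rule min[OF Y(1)])
    also have "\<dots> = (?N (\<lambda>h. A h - Y h))\<^sup>2"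
      by (simp add: Y(2) F.weighted_norm_def S.zero flip: S_def)
    also have "\<dots> < (sqrt v)\<^sup>2" by (intro power_strict_mono Y(3) N_nonneg) simp
    also have "\<dots> = v" using \<open>v > 0\<close> by simp
    finally show False by simp
  qed
  then have "?N (\<lambda>h. A h - X h) = 0" and w0: "?w (X x - b) = 0"
    by (simp_all add: v_def add_nonneg_eq_0_iff)
  define E where "E = (SOME E. H.orthonormal_basis E)"
  have E: "H.orthonormal_basis E"
    unfolding E_def by (rule someI_ex) (rule H.orthonormal_basis_exists)
  define D where "D h = A h - X h" for h
  have D: "D \<in> bounded_ops sH sF"
    using assms(3) X unfolding bounded_ops_iff[OF assms(1,2)]
    unfolding D_def by (auto simp: F.scale_right_diff_distrib intro: bounded_linear_sub)
  have sum: "(\<lambda>e. (norm (S (D e)))\<^sup>2) summable_on E"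
    using E assms(5) by (intro hilbert_schmidt_comp_summable[OF assms(1,2) D S])
      (simp_all add: S_def H.orthonormal_basis_iff)
  have "(\<Sum>\<^sub>\<infinity>e\<in>E. (norm (S (D e)))\<^sup>2) = 0"
    using \<open>?N (\<lambda>h. A h - X h) = 0\<close>
    by (simp add: weighted_hs_norm_def H.hs_norm_def D_def E_def S_def)
  then have "S (D e) = 0" if "e \<in> E" for e
    using nonneg_infsum_le_0D[OF _ sum _ that] by simp
  moreover have "(\<lambda>h. S (D h)) \<in> bounded_ops sH sF"
    using D S unfolding F.positive_semidefinite_def F.endo_bounded_ops_iff bounded_ops_iff[OF assms(1,2)]
    by (auto intro: bounded_linear_compose)
  ultimately have "S (D x) = 0"
    using bounded_ops_eq_0_on_basis[OF assms(1,2) _ E] by blast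
  moreover have "S (X x - b) = 0" using w0 by (simp add: F.weighted_norm_def S_def)
  ultimately have "S (b - A x) = 0"
    by (simp add: D_def S.diff)
  then have "W (b - A x) = 0" unfolding S_def by (rule F.sqrt_op_eq_0D[OF assms(4)])
  then have "b \<in> {A x + z |x z. W z = 0}" 
    by (intro CollectI exI[of _ x] exI[of _ "b - A x"]) simp
  with assms(6) show False by contradiction
qed

end
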